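(* Let $p$ be an odd prime. For non-negative integers $m,n$, $$N(m,n)=\begin{cases}N(m-p,n-2)+N\left(\frac mp,n\right) & \text{if } p\mid m,\\[1ex] N(m-p,n-2)+N\left(\frac{m-1}p,n-1\right) & \text{if } m\equiv1\pmod p.\end{cases}$$
   Context: For integers $m,n$ and $r\ge1$, $N_r(m,n)$ is the number of pairs $(\mathfrak a,\mathfrak b)$, $\mathfrak a=(a_1,\dots,a_r)\in\mathbb N^r$, $\mathfrak b=(b_1,\dots,b_r)\in\{0,1\}^r$ (with $\mathbb N=\{0,1,2,\dots\}$), satisfying $2\sum_{i=1}^r a_i+\sum_{j=1}^r b_j=n$ and $b_1+\sum_{i=1}^{r-1}(a_i+b_{i+1})p^i+a_rp^r=m$. This number does not depend on $r$ once $p^r>m$, and $N(m,n)$ denotes this stable value; in particular $N(m,n)=0$ if $m<0$ or $n<0$. *)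

theory Defs
  imports "HOL-Number_Theory.Number_Theory" "HOL-Library.FuncSet"
begin

definition N_pairs :: "nat \<Rightarrow> nat \<Rightarrow> int \<Rightarrow> int \<Rightarrow> ((nat \<Rightarrow> nat) \<times> (nat \<Rightarrow> nat)) set" where
  "N_pairs p r m n = {(a, b).
     a \<in> {1..r} \<rightarrow>\<^sub>E UNIV \<and> b \<in> {1..r} \<rightarrow>\<^sub>E {0, 1} \<and>
     int (2 * (\<Sum>i=1..r. a i) + (\<Sum>j=1..r. b j)) = n \<and>
     int (b 1 + (\<Sum>i=1..r-1. (a i + b (i + 1)) * p ^ i) + a r * p ^ r) = m}"

definition N_r :: "nat \<Rightarrow> nat \<Rightarrow> int \<Rightarrow> int \<Rightarrow> nat" where
  "N_r p r m n = card (N_pairs p r m n)"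

text \<open>The description below determines a unique value whenever \<open>p \<ge> 2\<close>;
  see \<open>N_eq_N_r\<close>.\<close>

definition N :: "nat \<Rightarrow> int \<Rightarrow> int \<Rightarrow> nat" where
  "N p m n = (THE k. \<forall>r\<ge>1. int p ^ r > m \<longrightarrow> N_r p r m n = k)"

lemma finite_N_pairs: "finite (N_pairs p r m n)"
proof -
  have "N_pairs p r m n \<subseteq> ({1..r} \<rightarrow>\<^sub>E {..nat n}) \<times> ({1..r} \<rightarrow>\<^sub>E {0, 1})"
  proof
    fix x assume x: "x \<in> N_pairs p r m n"
    obtain a b where ab: "x = (a, b)" by (cases x)
    have a: "a \<in> {1..r} \<rightarrow>\<^sub>E UNIV" and b: "b \<in> {1..r} \<rightarrow>\<^sub>E {0, 1}"
      and n: "int (2 * (\<Sum>i=1..r. a i) + (\<Sum>j=1..r. b j)) = n"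
      using x by (auto simp: N_pairs_def ab)
    have "a i \<le> nat n" if "i \<in> {1..r}" for i
    proof -
      have "a i \<le> (\<Sum>i=1..r. a i)"
        using that by (intro member_le_sum) auto
      then show ?thesis using n by linarith
    qed
    with a b show "x \<in> ({1..r} \<rightarrow>\<^sub>E {..nat n}) \<times> ({1..r} \<rightarrow>\<^sub>E {0, 1})"
      by (auto simp: ab PiE_iff)
  qed
  then show ?thesis
    by (rule finite_subset) (intro finite_cartesian_product finite_PiE; simp)
qed

lemma N_r_Suc:
  assumes "p \<ge> 2" "r \<ge> 1" "int p ^ r > m"
  shows "N_r p (Suc r) m n = N_r p r m n"
proof -
  let ?f = "\<lambda>(a, b). (a(Suc r := 0), b(Suc r := 0)) :: (nat \<Rightarrow> nat) \<times> (nat \<Rightarrow> nat)"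
  let ?g = "\<lambda>(a, b). (restrict a {1..r}, restrict b {1..r}) :: (nat \<Rightarrow> nat) \<times> (nat \<Rightarrow> nat)"
  have weight: "b 1 + (\<Sum>i=1..Suc r - 1. (a i + b (i + 1)) * p ^ i) + a (Suc r) * p ^ Suc r
      = b 1 + (\<Sum>i=1..r-1. (a i + b (i + 1)) * p ^ i) + a r * p ^ r
        + (b (Suc r) * p ^ r + a (Suc r) * p ^ Suc r)" for a b :: "nat \<Rightarrow> nat"
    using \<open>r \<ge> 1\<close> by (cases r) (auto simp: algebra_simps)
  have top: "a (Suc r) = 0 \<and> b (Suc r) = 0" if "(a, b) \<in> N_pairs p (Suc r) m n" for a b
  proof -
    have "int (b 1 + (\<Sum>i=1..Suc r - 1. (a i + b (i + 1)) * p ^ i) + a (Suc r) * p ^ Suc r) = m"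
      using that by (simp add: N_pairs_def)
    then have "int (b (Suc r) * p ^ r + a (Suc r) * p ^ Suc r) \<le> m"
      unfolding weight by linarith
    then have "int (b (Suc r) * p ^ r + a (Suc r) * p ^ Suc r) < int (p ^ r)"
      using assms(3) by simp
    then have "(b (Suc r) + a (Suc r) * p) * p ^ r < 1 * p ^ r"
      by (simp only: of_nat_less_iff) (simp add: algebra_simps)
    then have "b (Suc r) + a (Suc r) * p < 1"
      by (rule mult_less_cancel2[THEN iffD1, THEN conjunct2])
    then show ?thesis using \<open>p \<ge> 2\<close> by simp
  qed
  have degree_eq: "2 * (\<Sum>i=1..Suc r. a' i) + (\<Sum>j=1..Suc r. b' j)
      = 2 * (\<Sum>i=1..r. a i) + (\<Sum>j=1..r. b j)"
    and weight_eq: "b' 1 + (\<Sum>i=1..Suc r - 1. (a' i + b' (i + 1)) * p ^ i) + a' (Suc r) * p ^ Suc r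
      = b 1 + (\<Sum>i=1..r-1. (a i + b (i + 1)) * p ^ i) + a r * p ^ r"
    if eq: "\<And>i. i \<in> {1..r} \<Longrightarrow> a' i = a i" "\<And>i. i \<in> {1..r} \<Longrightarrow> b' i = b i"
      and zero: "a' (Suc r) = 0" "b' (Suc r) = 0"
    for a b a' b' :: "nat \<Rightarrow> nat"
  proof -
    have "(\<Sum>i=1..r. a' i) = (\<Sum>i=1..r. a i)" "(\<Sum>j=1..r. b' j) = (\<Sum>j=1..r. b j)"
      by (rule sum.cong; simp add: eq)+
    then show "2 * (\<Sum>i=1..Suc r. a' i) + (\<Sum>j=1..Suc r. b' j)
        = 2 * (\<Sum>i=1..r. a i) + (\<Sum>j=1..r. b j)"
      using zero by simp
    have "(\<Sum>i=1..r-1. (a' i + b' (i + 1)) * p ^ i) = (\<Sum>i=1..r-1. (a i + b (i + 1)) * p ^ i)"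
    proof (rule sum.cong[OF refl])
      fix i assume "i \<in> {1..r-1}"
      then have "i \<in> {1..r}" "i + 1 \<in> {1..r}" by auto
      then show "(a' i + b' (i + 1)) * p ^ i = (a i + b (i + 1)) * p ^ i"
        using eq by simp
    qed
    moreover have "b' 1 = b 1" "a' r = a r"
      using eq \<open>r \<ge> 1\<close> by simp_all
    ultimately show "b' 1 + (\<Sum>i=1..Suc r - 1. (a' i + b' (i + 1)) * p ^ i) + a' (Suc r) * p ^ Suc r
        = b 1 + (\<Sum>i=1..r-1. (a i + b (i + 1)) * p ^ i) + a r * p ^ r"
      unfolding weight using zero by simp
  qed
  have ivl: "{1..Suc r} = insert (Suc r) {1..r}" by auto
  have gf: "restrict (c(Suc r := 0)) {1..r} = c" if "c \<in> {1..r} \<rightarrow>\<^sub>E A" for c :: "nat \<Rightarrow> nat" and A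
  proof
    show "restrict (c(Suc r := 0)) {1..r} i = c i" for i
      using PiE_arb[OF that] by (cases "i \<in> {1..r}") auto
  qed
  have fg: "(restrict c {1..r})(Suc r := 0) = c"
    if "c \<in> {1..Suc r} \<rightarrow>\<^sub>E A" "c (Suc r) = 0" for c :: "nat \<Rightarrow> nat" and A
  proof
    show "((restrict c {1..r})(Suc r := 0)) i = c i" for i
      using PiE_arb[OF that(1), of i] that(2)
      by (cases "i = Suc r"; cases "i \<in> {1..r}") auto
  qed
  have memD: "a \<in> {1..s} \<rightarrow>\<^sub>E UNIV" "b \<in> {1..s} \<rightarrow>\<^sub>E {0, 1}"
    if "(a, b) \<in> N_pairs p s m n" for a b s
    using that unfolding N_pairs_def mem_Collect_eq prod.case by blast+
  have "bij_betw ?f (N_pairs p r m n) (N_pairs p (Suc r) m n)"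
  proof (rule bij_betw_byWitness[where f' = ?g])
    show "\<forall>x\<in>N_pairs p r m n. ?g (?f x) = x"
    proof
      fix x assume x: "x \<in> N_pairs p r m n"
      obtain a b where ab: "x = (a, b)" by (cases x)
      note mem = memD[OF x[unfolded ab]]
      show "?g (?f x) = x"
        by (simp only: ab prod.case gf[OF mem(1)] gf[OF mem(2)])
    qed
    show "\<forall>x\<in>N_pairs p (Suc r) m n. ?f (?g x) = x"
    proof
      fix x assume x: "x \<in> N_pairs p (Suc r) m n"
      obtain a b where ab: "x = (a, b)" by (cases x)
      note mem = memD[OF x[unfolded ab]]
      have "a (Suc r) = 0" "b (Suc r) = 0"
        using top[OF x[unfolded ab]] by blast+
      then show "?f (?g x) = x"
        by (simp only: ab prod.case fg[OF mem(1)] fg[OF mem(2)])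
    qed
    show "?f ` N_pairs p r m n \<subseteq> N_pairs p (Suc r) m n"
    proof (rule image_subsetI)
      fix x assume x: "x \<in> N_pairs p r m n"
      obtain a b where ab: "x = (a, b)" by (cases x)
      let ?a = "a(Suc r := 0)" and ?b = "b(Suc r := 0)"
      note mem = memD[OF x[unfolded ab]]
      have "?a \<in> {1..Suc r} \<rightarrow>\<^sub>E UNIV" "?b \<in> {1..Suc r} \<rightarrow>\<^sub>E {0, 1}"
        unfolding ivl by (rule PiE_fun_upd, simp, rule mem)+
      moreover note degree_eq[of ?a a ?b b] weight_eq[of ?a a ?b b]
      ultimately have "(?a, ?b) \<in> N_pairs p (Suc r) m n"
        using x unfolding N_pairs_def ab mem_Collect_eq prod.case by simp
      then show "?f x \<in> N_pairs p (Suc r) m n" by (simp add: ab)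
    qed
    show "?g ` N_pairs p (Suc r) m n \<subseteq> N_pairs p r m n"
    proof (rule image_subsetI)
      fix x assume x: "x \<in> N_pairs p (Suc r) m n"
      obtain a b where ab: "x = (a, b)" by (cases x)
      let ?a = "restrict a {1..r}" and ?b = "restrict b {1..r}"
      have mem: "a \<in> {1..Suc r} \<rightarrow>\<^sub>E UNIV" "b \<in> {1..Suc r} \<rightarrow>\<^sub>E {0, 1}"
        and eqs: "int (2 * (\<Sum>i=1..Suc r. a i) + (\<Sum>j=1..Suc r. b j)) = n"
        "int (b 1 + (\<Sum>i=1..Suc r - 1. (a i + b (i + 1)) * p ^ i) + a (Suc r) * p ^ Suc r) = m"
        using x unfolding N_pairs_def ab mem_Collect_eq prod.case by blast+
      have zero: "a (Suc r) = 0" "b (Suc r) = 0"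
        using top[of a b] x by (auto simp: ab)
      have "?a \<in> {1..r} \<rightarrow>\<^sub>E UNIV" "?b \<in> {1..r} \<rightarrow>\<^sub>E {0, 1}"
        using mem[THEN PiE_mem] by simp_all
      moreover have "int (2 * (\<Sum>i=1..r. ?a i) + (\<Sum>j=1..r. ?b j)) = n"
        using degree_eq[of a ?a b ?b] eqs(1) zero by (metis restrict_apply')
      moreover have "int (?b 1 + (\<Sum>i=1..r-1. (?a i + ?b (i + 1)) * p ^ i) + ?a r * p ^ r) = m"
        unfolding eqs(2)[symmetric]
        by (rule arg_cong[where f = int], rule weight_eq[of a ?a b ?b, symmetric]) (use zero in simp_all)
      ultimately have "(?a, ?b) \<in> N_pairs p r m n"
        unfolding N_pairs_def mem_Collect_eq prod.case by blast
      then show "?g x \<in> N_pairs p r m n" by (simp add: ab)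
    qed
  qed
  then show ?thesis
    unfolding N_r_def by (simp add: bij_betw_same_card)
qed

lemma N_eq_N_r:
  assumes "p \<ge> 2" "r \<ge> 1" "int p ^ r > m"
  shows "N p m n = N_r p r m n"
proof -
  have stable: "N_r p t m n = N_r p s m n" if "s \<le> t" "s \<ge> 1" "int p ^ s > m" for s t
    using \<open>s \<le> t\<close>
  proof (induction t rule: dec_induct)
    case (step t)
    have "int p ^ s \<le> int p ^ t"
      using step.hyps \<open>p \<ge> 2\<close> by (intro power_increasing) auto
    then have "m < int p ^ t" using that by linarith
    then show ?case
      using N_r_Suc[of p t m n] step that \<open>p \<ge> 2\<close> by simp
  qed simp
  have "N_r p s m n = N_r p r m n" if "s \<ge> 1" "int p ^ s > m" for s
    using stable[of s r] stable[of r s] that assms by (metis nat_le_linear)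
  then show ?thesis
    unfolding N_def using assms by (intro the_equality) blast+
qed

end

theory Submission
  imports Defs
begin

text \<open>Modulo \<open>p\<close> only \<open>b\<^sub>1\<close> contributes to \<open>m\<close>, so \<open>m mod p\<close> determines \<open>b\<^sub>1\<close>. The pairs with
  \<open>a\<^sub>1 > 0\<close> are counted by lowering \<open>a\<^sub>1\<close> by one; in a pair with \<open>a\<^sub>1 = 0\<close> one deletes \<open>a\<^sub>1\<close> and
  \<open>b\<^sub>1\<close> and divides the remaining weight by \<open>p\<close>.\<close>

lemma sum_atLeast1_atMost_Suc:
  "(\<Sum>i=1..Suc r. h i) = h 1 + (\<Sum>i=1..r. h (Suc i) :: 'a :: comm_monoid_add)"
  by (induction r) (auto simp: add.assoc)

text \<open>Splitting the weight gives \<open>b j\<close> the factor \<open>p ^ (j - 1)\<close> and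
  \<open>a i\<close> the factor \<open>p ^ i\<close>, with no special first or last term. In this
  form a shift of indices by one is a multiplication by \<open>p\<close>.\<close>

lemma mem_N_pairs_iff:
  assumes "r \<ge> 1"
  shows "(a, b) \<in> N_pairs p r m n \<longleftrightarrow>
    a \<in> {1..r} \<rightarrow>\<^sub>E UNIV \<and> b \<in> {1..r} \<rightarrow>\<^sub>E {0, 1} \<and>
    int (2 * (\<Sum>i=1..r. a i) + (\<Sum>j=1..r. b j)) = n \<and>
    int ((\<Sum>j=1..r. b j * p ^ (j - 1)) + (\<Sum>i=1..r. a i * p ^ i)) = m"
proof -
  obtain s where s: "r = Suc s" using assms by (cases r) auto
  have "(\<Sum>j=1..r. b j * p ^ (j - 1)) = b 1 + (\<Sum>i=1..s. b (i + 1) * p ^ i)"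
    unfolding s by (subst sum_atLeast1_atMost_Suc) simp
  then have "(\<Sum>j=1..r. b j * p ^ (j - 1)) + (\<Sum>i=1..r. a i * p ^ i)
      = b 1 + (\<Sum>i=1..r-1. (a i + b (i + 1)) * p ^ i) + a r * p ^ r"
    by (simp add: s algebra_simps sum.distrib)
  then show ?thesis by (simp add: N_pairs_def)
qed

text \<open>The weights \<open>w\<close> are left arbitrary so that both constraints are covered:
  \<open>w i = p ^ i\<close> for \<open>m\<close> and \<open>w i = 1\<close> for
  \<open>n\<close>.\<close>

lemma sum_fun_upd_Suc:
  fixes a w :: "'a \<Rightarrow> nat"
  assumes "finite S" "x \<in> S"
  shows "(\<Sum>i\<in>S. (a(x := Suc (a x))) i * w i) = (\<Sum>i\<in>S. a i * w i) + w x"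
proof -
  have "(\<Sum>i\<in>S - {x}. (a(x := Suc (a x))) i * w i) = (\<Sum>i\<in>S - {x}. a i * w i)"
    by (rule sum.cong) auto
  then show ?thesis using assms by (simp add: sum.remove)
qed

text \<open>Raising \<open>a 1\<close> by one adds \<open>p\<close> to the weight and 2 to the
  degree, and the pairs with \<open>a 1 > 0\<close> are exactly those reached in this way. The
  number \<open>r\<close> of entries stays the same.\<close>

lemma card_N_pairs_first_pos:
  assumes "r \<ge> 1"
  shows "card {(a, b) \<in> N_pairs p r m n. a 1 > 0} = N_r p r (m - int p) (n - 2)"
proof -
  let ?f = "\<lambda>(a, b). (a(1 := Suc (a 1)), b) :: (nat \<Rightarrow> nat) \<times> (nat \<Rightarrow> nat)"
  let ?g = "\<lambda>(a, b). (a(1 := a 1 - 1), b) :: (nat \<Rightarrow> nat) \<times> (nat \<Rightarrow> nat)"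
  have up: "(a(1 := Suc (a 1)), b) \<in> N_pairs p r m n \<longleftrightarrow>
      (a, b) \<in> N_pairs p r (m - int p) (n - 2)" for a b
  proof -
    have "(\<Sum>i=1..r. (a(1 := Suc (a 1))) i * p ^ i) = (\<Sum>i=1..r. a i * p ^ i) + p"
      using sum_fun_upd_Suc[of "{1..r}" 1 a "\<lambda>i. p ^ i"] assms by simp
    moreover have "(\<Sum>i=1..r. (a(1 := Suc (a 1))) i) = (\<Sum>i=1..r. a i) + 1"
      using sum_fun_upd_Suc[of "{1..r}" 1 a "\<lambda>_. 1"] assms by simp
    moreover have "a(1 := Suc (a 1)) \<in> {1..r} \<rightarrow>\<^sub>E UNIV \<longleftrightarrow> a \<in> {1..r} \<rightarrow>\<^sub>E UNIV"
      using assms by (auto simp: PiE_iff extensional_def)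
    ultimately show ?thesis
      unfolding mem_N_pairs_iff[OF assms] by (auto simp del: fun_upd_apply)
  qed
  have "bij_betw ?f (N_pairs p r (m - int p) (n - 2)) {(a, b) \<in> N_pairs p r m n. a 1 > 0}"
  proof (rule bij_betw_byWitness[where f' = ?g])
    show "\<forall>x\<in>N_pairs p r (m - int p) (n - 2). ?g (?f x) = x"
      by auto
    show "\<forall>x\<in>{(a, b) \<in> N_pairs p r m n. a 1 > 0}. ?f (?g x) = x"
      by auto
    show "?f ` N_pairs p r (m - int p) (n - 2) \<subseteq> {(a, b) \<in> N_pairs p r m n. a 1 > 0}"
      using up by auto
    show "?g ` {(a, b) \<in> N_pairs p r m n. a 1 > 0} \<subseteq> N_pairs p r (m - int p) (n - 2)"
    proof (rule image_subsetI)
      fix x assume "x \<in> {(a, b) \<in> N_pairs p r m n. a 1 > 0}"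
      then obtain a b where x: "x = (a, b)" "(a, b) \<in> N_pairs p r m n" "a 1 > 0" by auto
      \<comment> \<open>The truncated subtraction is harmless: since \<open>a 1 > 0\<close>, raising
        the lowered function gives back \<open>a\<close>, so \<open>up\<close> can be read from left
        to right.\<close>
      then show "?g x \<in> N_pairs p r (m - int p) (n - 2)"
        using up[of "a(1 := a 1 - 1)" b] by simp
    qed
  qed
  then show ?thesis unfolding N_r_def by (simp add: bij_betw_same_card)
qed

text \<open>With \<open>a 1 = 0\<close>, every remaining term of the weight except
  \<open>b 1\<close> is divisible by \<open>p\<close>. As \<open>b 1\<close> and \<open>c\<close>
  both lie in {0, 1} and \<open>p \<ge> 2\<close>, the residue forces \<open>b 1 = c\<close>, and
  the quotient is the weight of the shifted pair.\<close>

lemma mem_N_pairs_first_zero_iff: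
  assumes "r \<ge> 1" "p \<ge> 2" "c \<in> {0, 1}" "a 1 = 0"
    and "a \<in> {1..Suc r} \<rightarrow>\<^sub>E UNIV" "b \<in> {1..Suc r} \<rightarrow>\<^sub>E {0, 1}"
  shows "(a, b) \<in> N_pairs p (Suc r) (int c + int p * k) n \<longleftrightarrow>
    b 1 = c \<and> (\<lambda>i\<in>{1..r}. a (Suc i), \<lambda>i\<in>{1..r}. b (Suc i)) \<in> N_pairs p r k (n - int c)"
proof -
  \<comment> \<open>\<open>W\<close> and \<open>D\<close> are the weight and the degree of the pair
    left after deleting the first entries.\<close>
  define W where "W = (\<Sum>i=1..r. b (Suc i) * p ^ (i - 1)) + (\<Sum>i=1..r. a (Suc i) * p ^ i)"
  define D where "D = 2 * (\<Sum>i=1..r. a (Suc i)) + (\<Sum>i=1..r. b (Suc i))"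
  have b_shift: "(\<Sum>i=1..r. b (Suc i) * p ^ i) = p * (\<Sum>i=1..r. b (Suc i) * p ^ (i - 1))"
    unfolding sum_distrib_left
    by (rule sum.cong[OF refl]) (auto simp: power_eq_if)
  have w: "(\<Sum>j=1..Suc r. b j * p ^ (j - 1)) + (\<Sum>i=1..Suc r. a i * p ^ i) = b 1 + p * W"
    unfolding sum_atLeast1_atMost_Suc W_def using \<open>a 1 = 0\<close> b_shift
    by (simp add: algebra_simps sum_distrib_left)
  have d: "2 * (\<Sum>i=1..Suc r. a i) + (\<Sum>j=1..Suc r. b j) = b 1 + D"
    unfolding sum_atLeast1_atMost_Suc D_def using \<open>a 1 = 0\<close> by simp
  have b1: "b 1 \<in> {0, 1}" using assms(6) by (auto simp: PiE_iff)
  have digit: "int (b 1 + p * W) = int c + int p * k \<longleftrightarrow> b 1 = c \<and> int W = k"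
  proof
    assume eq: "int (b 1 + p * W) = int c + int p * k"
    \<comment> \<open>Reduction modulo \<open>p\<close> removes \<open>W\<close> and
      \<open>k\<close>; what remains on each side is less than \<open>p\<close>.\<close>
    then have "int (b 1 + p * W) mod int p = (int c + int p * k) mod int p" by simp
    then have "b 1 = c" using b1 assms(2,3) by auto
    then show "b 1 = c \<and> int W = k" using eq assms(2) by simp
  qed auto
  have "(\<lambda>i\<in>{1..r}. b (Suc i)) \<in> {1..r} \<rightarrow>\<^sub>E {0, 1}"
    using assms(6)[THEN PiE_mem] by auto
  then have tail: "(\<lambda>i\<in>{1..r}. a (Suc i), \<lambda>i\<in>{1..r}. b (Suc i)) \<in> N_pairs p r k (n - int c)
      \<longleftrightarrow> int D = n - int c \<and> int W = k"
    unfolding mem_N_pairs_iff[OF assms(1)] by (simp add: D_def W_def)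
  have "(a, b) \<in> N_pairs p (Suc r) (int c + int p * k) n \<longleftrightarrow>
      int (b 1 + D) = n \<and> int (b 1 + p * W) = int c + int p * k"
    using assms(5,6) mem_N_pairs_iff[of "Suc r"] by (simp only: w d) simp
  then show ?thesis unfolding tail digit by auto
qed

text \<open>Deletion of the first entries loses no information, because both are known:
  \<open>a 1 = 0\<close> and \<open>b 1 = c\<close>. The inverse puts them back in front, which is
  why \<open>Suc r\<close> drops to \<open>r\<close>.\<close>

lemma card_N_pairs_first_zero:
  assumes "r \<ge> 1" "p \<ge> 2" "c \<in> {0, 1}"
  shows "card {(a, b) \<in> N_pairs p (Suc r) (int c + int p * k) n. a 1 = 0} = N_r p r k (n - int c)"
proof -
  let ?A = "{(a, b) \<in> N_pairs p (Suc r) (int c + int p * k) n. a 1 = 0}"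
  let ?B = "N_pairs p r k (n - int c)"
  \<comment> \<open>The restriction to \<open>{1..Suc r}\<close> keeps the extended function
    extensional, as \<open>N_pairs\<close> demands.\<close>
  let ?cons = "\<lambda>(x::nat) (a :: nat \<Rightarrow> nat). \<lambda>i\<in>{1..Suc r}. if i = 1 then x else a (i - 1)"
  let ?tl = "\<lambda>a :: nat \<Rightarrow> nat. \<lambda>i\<in>{1..r}. a (Suc i)"
  let ?f = "\<lambda>(a, b). (?tl a, ?tl b)"
  let ?g = "\<lambda>(a, b). (?cons 0 a, ?cons c b)"
  have memD: "a \<in> {1..s} \<rightarrow>\<^sub>E UNIV" "b \<in> {1..s} \<rightarrow>\<^sub>E {0, 1}"
    if "(a, b) \<in> N_pairs p s l n'" for a b s l n'
    using that unfolding N_pairs_def by blast+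
  have tl_cons: "?tl (?cons x a) = a" if "a \<in> {1..r} \<rightarrow>\<^sub>E S" for x a S
  proof
    show "?tl (?cons x a) i = a i" for i
      using PiE_arb[OF that, of i] by (cases "i \<in> {1..r}") auto
  qed
  have cons_tl: "?cons x (?tl a) = a" if "a \<in> {1..Suc r} \<rightarrow>\<^sub>E S" "a 1 = x" for x a S
  proof
    show "?cons x (?tl a) i = a i" for i
      using PiE_arb[OF that(1), of i] that(2) by (cases "i \<in> {1..Suc r}") auto
  qed
  have A: "b 1 = c \<and> ?f (a, b) \<in> ?B" if "(a, b) \<in> ?A" for a b
  proof -
    have ab: "(a, b) \<in> N_pairs p (Suc r) (int c + int p * k) n" "a 1 = 0" using that by auto
    show ?thesis
      using mem_N_pairs_first_zero_iff[of r p c a b k n, OF assms ab(2) memD[OF ab(1)]] ab(1) by simp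
  qed
  have "bij_betw ?f ?A ?B"
  proof (rule bij_betw_byWitness[where f' = ?g])
    show "\<forall>x\<in>?A. ?g (?f x) = x"
    proof (rule ballI)
      fix x assume x: "x \<in> ?A"
      then obtain a b where ab: "x = (a, b)" by (cases x)
      have N: "(a, b) \<in> N_pairs p (Suc r) (int c + int p * k) n" "a 1 = 0" "b 1 = c"
        using x A[of a b] ab by auto
      show "?g (?f x) = x"
        by (simp only: ab prod.case cons_tl[OF memD(1)[OF N(1)] N(2)] cons_tl[OF memD(2)[OF N(1)] N(3)])
    qed
    show "\<forall>x\<in>?B. ?f (?g x) = x"
    proof (rule ballI)
      fix x assume x: "x \<in> ?B"
      then obtain a b where ab: "x = (a, b)" by (cases x)
      note mem = memD[OF x[unfolded ab]]
      show "?f (?g x) = x"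
        by (simp only: ab prod.case tl_cons[OF mem(1)] tl_cons[OF mem(2)])
    qed
    show "?f ` ?A \<subseteq> ?B" using A by blast
    show "?g ` ?B \<subseteq> ?A"
    proof (rule image_subsetI)
      fix x assume x: "x \<in> ?B"
      then obtain a b where ab: "x = (a, b)" by (cases x)
      note mem = memD[OF x[unfolded ab]]
      have "?cons c b i \<in> {0, 1}" if "i \<in> {1..Suc r}" for i
        using that assms(3) PiE_mem[OF mem(2), of "i - 1"] by (cases i; cases "i = 1") simp_all
      then have "?cons c b \<in> {1..Suc r} \<rightarrow>\<^sub>E {0, 1}" by (intro PiE_I) auto
      moreover have "?cons 0 a \<in> {1..Suc r} \<rightarrow>\<^sub>E UNIV" by auto
      moreover have "(?tl (?cons 0 a), ?tl (?cons c b)) \<in> ?B"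
        unfolding tl_cons[OF mem(1)] tl_cons[OF mem(2)] using x ab by blast
      ultimately have "(?cons 0 a, ?cons c b) \<in> N_pairs p (Suc r) (int c + int p * k) n"
        using mem_N_pairs_first_zero_iff[of r p c "?cons 0 a" "?cons c b" k n] assms by simp
      then show "?g x \<in> ?A" by (simp add: ab)
    qed
  qed
  then show ?thesis unfolding N_r_def by (rule bij_betw_same_card)
qed

text \<open>The two cases of the theorem are \<open>c = 0\<close> and \<open>c = 1\<close>, with
  \<open>k\<close> the quotient of \<open>m\<close> by \<open>p\<close>.\<close>

lemma N_recurrence:
  assumes "p \<ge> 2" "c \<in> {0, 1}" "k \<ge> 0"
  shows "N p (int c + int p * k) n = N p (int c + int p * k - int p) (n - 2) + N p k (n - int c)"
proof -
  let ?m = "int c + int p * k"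
  obtain r where r: "r \<ge> 1" "?m < int p ^ r"
  proof
    \<comment> \<open>The exponent is \<open>Suc (nat ?m)\<close> rather than \<open>nat ?m\<close>
      to ensure \<open>r \<ge> 1\<close> even for \<open>?m = 0\<close>.\<close>
    have "nat ?m < 2 ^ nat ?m" by (rule less_exp)
    also have "\<dots> \<le> p ^ Suc (nat ?m)"
      using assms(1) power_mono[of 2 p "nat ?m"] power_increasing[of "nat ?m" "Suc (nat ?m)" p]
      by linarith
    finally show "?m < int p ^ Suc (nat ?m)" using assms(3) by (simp add: nat_less_iff)
  qed simp
  \<comment> \<open>Since \<open>k \<ge> 0\<close>, this gives \<open>k \<le> ?m\<close>, so level
    \<open>r\<close> is already stable for \<open>k\<close>.\<close>
  have "int p * k \<ge> 1 * k" using assms by (intro mult_right_mono) auto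
  then have k: "k < int p ^ r" using r by linarith
  have "int p ^ r \<le> int p ^ Suc r" using assms(1) by (intro power_increasing) auto
  then have m: "?m < int p ^ Suc r" using r by linarith
  have "N_r p (Suc r) ?m n = card ({(a, b) \<in> N_pairs p (Suc r) ?m n. a 1 > 0}
      \<union> {(a, b) \<in> N_pairs p (Suc r) ?m n. a 1 = 0})"
    unfolding N_r_def by (rule arg_cong[where f = card]) auto
  also have "\<dots> = card {(a, b) \<in> N_pairs p (Suc r) ?m n. a 1 > 0}
      + card {(a, b) \<in> N_pairs p (Suc r) ?m n. a 1 = 0}"
    by (intro card_Un_disjoint finite_subset[OF _ finite_N_pairs[of p "Suc r" ?m n]]) auto
  also have "\<dots> = N_r p (Suc r) (?m - int p) (n - 2) + N_r p r k (n - int c)"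
    using card_N_pairs_first_pos card_N_pairs_first_zero[OF r(1) assms(1,2)] by simp
  \<comment> \<open>The counts live at different levels, \<open>Suc r\<close> for \<open>?m\<close>
    and \<open>?m - int p\<close> but \<open>r\<close> for \<open>k\<close>; each level is in the
    stable range, so all three are values of \<open>N\<close>.\<close>
  finally show ?thesis
    using r k m assms(1) N_eq_N_r[of p "Suc r" ?m] N_eq_N_r[of p "Suc r" "?m - int p"] N_eq_N_r[of p r k]
    by simp
qed

theorem corollary3p5:
  fixes p :: nat and m n :: int
  assumes "prime p" and "odd p" and "m \<ge> 0" and "n \<ge> 0"
  shows "(int p dvd m \<longrightarrow> N p m n = N p (m - int p) (n - 2) + N p (m div int p) n) \<and>
         ([m = 1] (mod int p) \<longrightarrow>
            N p m n = N p (m - int p) (n - 2) + N p ((m - 1) div int p) (n - 1))"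
proof -
  have p: "p \<ge> 2" using assms(1) by (rule prime_ge_2_nat)
  have rec: "N p m n = N p (m - int p) (n - 2) + N p (m div int p) (n - int c)"
    if "m mod int p = int c" "c \<in> {0, 1}" for c
  proof -
    have "m = int c + int p * (m div int p)"
      using that(1) by (metis mod_mult_div_eq)
    moreover have "m div int p \<ge> 0" using assms(3) p by (simp add: pos_imp_zdiv_nonneg_iff)
    ultimately show ?thesis using N_recurrence[OF p that(2), of "m div int p" n] by simp
  qed
  have one: "m mod int p = 1" if "[m = 1] (mod int p)"
    using that p by (simp add: cong_def)
  \<comment> \<open>Here \<open>m - 1\<close> is \<open>p\<close> times \<open>m div int p\<close>,
    so the quotient stated for residue 1 is the one supplied by \<open>rec\<close>.\<close>
  moreover have "(m - 1) div int p = m div int p" if "m mod int p = 1"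
    using that p by (metis add_diff_cancel_left' mod_mult_div_eq nonzero_mult_div_cancel_left
        not_numeral_le_zero of_nat_eq_0_iff)
  ultimately show ?thesis using rec[of 0] rec[of 1] by auto
qed

end
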